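(* There is a universal constant $c$ for which the following holds: for any $0 < \varepsilon \leq 1$, any positive integer $k$, and any finite dataset $X \subseteq \mathbb{R}^d$, if $S$ is a set of centers sampled from $X$ by $D^2$-sampling with $|S| = \Omega(\mathcal{L}_X^{k, \varepsilon/c})$, then with high probability $\Phi(S, X) \leq \varepsilon \cdot \Delta_k(X)$.
   Context: For finite $C, X \subseteq \mathbb{R}^d$, $\Phi(C, X) = \sum_{x \in X} \min_{c \in C} \|x - c\|^2$, and $\Delta_k(X)$ is the minimum of $\Phi(C, X)$ over all sets $C \subseteq \mathbb{R}^d$ of $k$ centers. For $0 < \delta \leq 1$, $\mathcal{L}_X^{k, \delta}$ denotes the smallest integer $L$ with $\Delta_L(X) \leq \delta \cdot \Delta_k(X)$. $D^2$-sampling (the $k$-means++ seeding procedure): the first center is a uniformly random point of $X$; having chosen centers $C_{i-1}$, the $i$-th center is a point $x \in X$ chosen with probability proportional to $\min_{c \in C_{i-1}} \|x - c\|^2$; sampling continues until the desired number of centers is chosen. The $\Omega$ hides a universal constant. *)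

theory Defs
  imports "HOL-Probability.Probability" "HOL-Analysis.Abstract_Euclidean_Space"
begin

text \<open>
  Points of \<open>\<real>\<^sup>d\<close> are the elements of \<^term>\<open>topspace (Euclidean_space d)\<close>, that is, functions
  \<^typ>\<open>nat \<Rightarrow> real\<close> vanishing at all indices \<open>\<ge> d\<close>.  The dimension has to be a natural number
  rather than a type, because the constants in the theorem must not depend on it.
\<close>

definition edist :: "nat \<Rightarrow> (nat \<Rightarrow> real) \<Rightarrow> (nat \<Rightarrow> real) \<Rightarrow> real" where
  "edist d x y = L2_set (\<lambda>i. x i - y i) {..<d}"

definition min_sqdist :: "nat \<Rightarrow> (nat \<Rightarrow> real) set \<Rightarrow> (nat \<Rightarrow> real) \<Rightarrow> real" where
  "min_sqdist d C x = Min ((\<lambda>c. (edist d x c)\<^sup>2) ` C)"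

text \<open>Only used for finite nonempty \<open>C\<close>.\<close>

definition kmeans_cost :: "nat \<Rightarrow> (nat \<Rightarrow> real) set \<Rightarrow> (nat \<Rightarrow> real) set \<Rightarrow> real" where
  "kmeans_cost d C X = (\<Sum>x\<in>X. min_sqdist d C x)"

text \<open>
  The infimum is attained for \<open>k \<ge> 1\<close>, \<open>d \<ge> 1\<close> and finite \<open>X\<close>, so it is the minimum
  over all sets of exactly \<open>k\<close> centers; the centers need not belong to \<open>X\<close>.
\<close>

definition opt_cost :: "nat \<Rightarrow> nat \<Rightarrow> (nat \<Rightarrow> real) set \<Rightarrow> real" where
  "opt_cost d k X =
    (INF C\<in>{C. C \<subseteq> topspace (Euclidean_space d) \<and> finite C \<and> card C = k}. kmeans_cost d C X)"

text \<open>\<open>L = 0\<close> is excluded since the cost of the empty set of centers is meaningless (infinite).\<close>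

definition num_centers :: "nat \<Rightarrow> nat \<Rightarrow> real \<Rightarrow> (nat \<Rightarrow> real) set \<Rightarrow> nat" where
  "num_centers d k \<delta> X = (LEAST L. 1 \<le> L \<and> opt_cost d L X \<le> \<delta> * opt_cost d k X)"

definition d2_point :: "nat \<Rightarrow> (nat \<Rightarrow> real) set \<Rightarrow> (nat \<Rightarrow> real) set \<Rightarrow> (nat \<Rightarrow> real) pmf" where
  "d2_point d X C =
    embed_pmf (\<lambda>x. if x \<in> X then min_sqdist d C x / kmeans_cost d C X else 0)"

text \<open>
  If \<open>C\<close> has cost \<open>0\<close>, the weights are all zero and there is no next center to sample; the
  procedure then stays at \<open>C\<close>.  For centers taken from \<open>X\<close> this happens only once every point
  of \<open>X\<close> has been chosen; until then each step adds a new point.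
\<close>

definition d2_step :: "nat \<Rightarrow> (nat \<Rightarrow> real) set \<Rightarrow> (nat \<Rightarrow> real) set \<Rightarrow> (nat \<Rightarrow> real) set pmf" where
  "d2_step d X C =
    (if C = {} then map_pmf (\<lambda>x. {x}) (pmf_of_set X)
     else if kmeans_cost d C X = 0 then return_pmf C
     else map_pmf (\<lambda>x. insert x C) (d2_point d X C))"

primrec d2_sampling :: "nat \<Rightarrow> (nat \<Rightarrow> real) set \<Rightarrow> nat \<Rightarrow> (nat \<Rightarrow> real) set pmf" where
  "d2_sampling d X 0 = return_pmf {}"
| "d2_sampling d X (Suc n) = bind_pmf (d2_sampling d X n) (d2_step d X)"

lemma min_sqdist_nonneg:
  assumes "finite C" "C \<noteq> {}"
  shows "0 \<le> min_sqdist d C x"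
  using assms by (simp add: min_sqdist_def)

lemma kmeans_cost_nonneg:
  assumes "finite C" "C \<noteq> {}"
  shows "0 \<le> kmeans_cost d C X"
  unfolding kmeans_cost_def using min_sqdist_nonneg[OF assms] by (simp add: sum_nonneg)

text \<open>The weights in \<^const>\<open>d2_point\<close> do form a probability distribution.\<close>

lemma pmf_d2_point:
  assumes X: "finite X" and C: "finite C" "C \<noteq> {}" and pos: "kmeans_cost d C X \<noteq> 0"
  shows "pmf (d2_point d X C) x = (if x \<in> X then min_sqdist d C x / kmeans_cost d C X else 0)"
proof -
  let ?f = "\<lambda>x. if x \<in> X then min_sqdist d C x / kmeans_cost d C X else 0"
  have nn: "0 \<le> ?f x" for x
    using min_sqdist_nonneg[OF C] kmeans_cost_nonneg[OF C] by simp
  have "(\<integral>\<^sup>+x. ennreal (?f x) \<partial>count_space UNIV) = (\<Sum>x\<in>X. ennreal (?f x))"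
    using X by (subst nn_integral_count_space'[of X]) auto
  also have "\<dots> = ennreal (\<Sum>x\<in>X. ?f x)"
    by (rule sum_ennreal) (rule nn)
  also have "(\<Sum>x\<in>X. ?f x) = 1"
    using pos by (simp add: sum_divide_distrib[symmetric] kmeans_cost_def[symmetric])
  finally show ?thesis
    unfolding d2_point_def using nn by (subst pmf_embed_pmf) auto
qed

end

theory Submission
  imports Defs
begin

text \<open>
  Fix a reference set \<open>C\<close> of \<open>L\<close> centers and partition \<open>X\<close> into the cells of the points served by each
  \<open>c \<in> C\<close>.  Call a cell bad for \<open>S\<close> if \<open>S\<close> costs more than 20 times as much as \<open>c\<close> on it.  While
  \<open>S\<close> costs more than 40 times as much as \<open>C\<close> in total, the next sample falls into a bad cell with
  probability at least 1/2, and then, with probability at least 1/16, into the core of that cell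
  (the points whose squared distance to \<open>c\<close> is at most twice the average), which makes the cell good
  forever.  Hence the expectation of \<open>2 ^ (number of bad cells)\<close>, restricted to the event that the
  cost is still too large, shrinks by the factor \<open>1 - 1/64\<close> in each step, and it starts at no more
  than \<open>2 ^ L\<close>.  Since only finitely many \<open>S\<close> can occur, the cost of \<open>C\<close> may be replaced by the
  infimum over all \<open>C\<close>.
\<close>

section \<open>Squared distances\<close>

lemma edist_sq: "(edist d x y)\<^sup>2 = (\<Sum>i<d. (x i - y i)\<^sup>2)"
  by (simp add: edist_def L2_set_def sum_nonneg)

lemma edist_commute: "edist d x y = edist d y x"
  by (simp add: edist_def L2_set_def power2_commute)

text \<open>Coordinatewise this is \<open>(u - v)^2 \<ge> 0\<close> for the two increments
  \<open>u\<close> and \<open>v\<close>. The factor 2 is the price of working with squares; the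
  later constants 6 and 20 reflect it.\<close>

lemma edist_sq_triangle: "(edist d x z)\<^sup>2 \<le> 2 * (edist d x y)\<^sup>2 + 2 * (edist d y z)\<^sup>2"
proof -
  have "(x i - z i)\<^sup>2 \<le> 2 * (x i - y i)\<^sup>2 + 2 * (y i - z i)\<^sup>2" for i
    using zero_le_power2[of "(x i - y i) - (y i - z i)"]
    by (simp add: power2_eq_square algebra_simps)
  then show ?thesis
    unfolding edist_sq by (simp add: sum_distrib_left sum.distrib[symmetric] sum_mono)
qed

lemma min_sqdist_le:
  assumes "finite C" "c \<in> C"
  shows "min_sqdist d C x \<le> (edist d x c)\<^sup>2"
  using assms by (simp add: min_sqdist_def)

lemma min_sqdist_attained:
  assumes "finite C" "C \<noteq> {}"
  obtains c where "c \<in> C" "min_sqdist d C x = (edist d x c)\<^sup>2"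
proof -
  have "min_sqdist d C x \<in> (\<lambda>c. (edist d x c)\<^sup>2) ` C"
    unfolding min_sqdist_def by (rule Min_in) (use assms in auto)
  then show ?thesis
    using that by blast
qed

lemma min_sqdist_triangle:
  assumes "finite S" "S \<noteq> {}"
  shows "min_sqdist d S x \<le> 2 * (edist d x y)\<^sup>2 + 2 * min_sqdist d S y"
proof -
  obtain c where "c \<in> S" "min_sqdist d S y = (edist d y c)\<^sup>2"
    using min_sqdist_attained[OF assms] .
  then show ?thesis
    using min_sqdist_le[OF assms(1), of c d x] edist_sq_triangle[of d x c y] by linarith
qed

lemma min_sqdist_antimono:
  assumes "finite T" "S \<noteq> {}" "S \<subseteq> T"
  shows "min_sqdist d T x \<le> min_sqdist d S x"
  unfolding min_sqdist_def using assms by (intro Min_antimono) auto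

lemma kmeans_cost_antimono:
  assumes "finite T" "S \<noteq> {}" "S \<subseteq> T"
  shows "kmeans_cost d T X \<le> kmeans_cost d S X"
  unfolding kmeans_cost_def by (intro sum_mono min_sqdist_antimono assms)

lemma kmeans_cost_singleton: "kmeans_cost d {c} X = (\<Sum>x\<in>X. (edist d x c)\<^sup>2)"
  by (simp add: kmeans_cost_def min_sqdist_def)

lemma kmeans_cost_self:
  assumes "finite X"
  shows "kmeans_cost d X X = 0"
proof -
  have "min_sqdist d X x = 0" if "x \<in> X" for x
    using min_sqdist_le[OF assms that, of d x] min_sqdist_nonneg[OF assms, of d x] that
    by (fastforce simp: edist_def L2_set_def)
  then show ?thesis
    by (simp add: kmeans_cost_def)
qed

section \<open>A single cell\<close>

text \<open>The inequality is multiplied by the cardinality so that no average has to be formed.\<close>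

definition core :: "nat \<Rightarrow> (nat \<Rightarrow> real) \<Rightarrow> (nat \<Rightarrow> real) set \<Rightarrow> (nat \<Rightarrow> real) set" where
  "core d c A = {x \<in> A. real (card A) * (edist d x c)\<^sup>2 \<le> 2 * kmeans_cost d {c} A}"

text \<open>Markov's inequality: points outside the core have squared distance above twice the
  average, so they make up at most half of \<open>A\<close>.\<close>

lemma card_core:
  assumes "finite A"
  shows "card A \<le> 2 * card (core d c A)"
\<comment> \<open>Cost 0 is split off because the Markov argument cancels \<open>v\<close>.\<close>
proof (cases "kmeans_cost d {c} A = 0")
  case True
  then have "\<forall>x\<in>A. (edist d x c)\<^sup>2 = 0"
    unfolding kmeans_cost_singleton using assms by (subst (asm) sum_nonneg_eq_0_iff) auto
  then have "core d c A = A"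
    using True by (auto simp: core_def)
  then show ?thesis
    by simp
next
  case False
  define v where "v = kmeans_cost d {c} A"
  define N where "N = A - core d c A"
  have v: "v > 0"
    using False kmeans_cost_nonneg[of "{c}" d A] by (simp add: v_def)
  have "real (card N) * (2 * v) \<le> (\<Sum>x\<in>N. real (card A) * (edist d x c)\<^sup>2)"
    using sum_bounded_below[of N "2 * v" "\<lambda>x. real (card A) * (edist d x c)\<^sup>2"]
    by (force simp: N_def core_def v_def)
  also have "\<dots> \<le> real (card A) * v"
    unfolding v_def kmeans_cost_singleton sum_distrib_left[symmetric]
    by (intro mult_left_mono sum_mono2) (auto simp: N_def assms)
  finally have "2 * real (card N) \<le> real (card A)"
    using v by simp
  moreover have "card A = card N + card (core d c A)"
  proof -
    have "core d c A \<subseteq> A"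
      by (auto simp: core_def)
    then show ?thesis
      unfolding N_def using assms card_mono[OF assms, of "core d c A"]
      by (simp add: card_Diff_subset finite_subset)
  qed
  ultimately show ?thesis
    by linarith
qed

text \<open>Badness forces \<open>c\<close> to be far from \<open>S\<close> compared with the radius
  of the core, so each core point is far from \<open>S\<close> as well, and the core holds at least
  half of the cell.\<close>

lemma cost_core_ge:
  assumes A: "finite A" and S: "finite S" "S \<noteq> {}"
    and bad: "20 * kmeans_cost d {c} A < kmeans_cost d S A"
  shows "kmeans_cost d S A / 16 \<le> kmeans_cost d S (core d c A)"
proof -
  define m v D where "m = real (card A)" and "v = kmeans_cost d {c} A" and "D = min_sqdist d S c"
  have v0: "v \<ge> 0"
    unfolding v_def by (rule kmeans_cost_nonneg) auto
  have "kmeans_cost d S A \<le> (\<Sum>x\<in>A. 2 * (edist d x c)\<^sup>2 + 2 * D)"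
    unfolding kmeans_cost_def D_def by (intro sum_mono min_sqdist_triangle S)
  also have "\<dots> = 2 * v + 2 * (m * D)"
    by (simp add: v_def kmeans_cost_singleton m_def sum.distrib sum_distrib_left)
  finally have upper: "kmeans_cost d S A \<le> 2 * v + 2 * (m * D)" .
  then have far: "9 * v < m * D"
    using bad unfolding v_def by linarith
  then have m: "m > 0"
    using v0 by (cases "m = 0") (auto simp: m_def)
  have point: "m * D / 2 - 2 * v \<le> m * min_sqdist d S x" if "x \<in> core d c A" for x
  proof -
    have "m * D \<le> m * (2 * (edist d c x)\<^sup>2 + 2 * min_sqdist d S x)"
      unfolding D_def using m by (intro mult_left_mono min_sqdist_triangle S) auto
    moreover have "m * (edist d c x)\<^sup>2 \<le> 2 * v"
      using that by (simp add: core_def m_def v_def edist_commute)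
    ultimately show ?thesis
      by (simp add: algebra_simps)
  qed
  have "m / 2 * (m * D / 2 - 2 * v) \<le> real (card (core d c A)) * (m * D / 2 - 2 * v)"
    using card_core[OF A, of d c] far v0 by (intro mult_right_mono) (auto simp: m_def)
  also have "\<dots> \<le> m * kmeans_cost d S (core d c A)"
    unfolding kmeans_cost_def sum_distrib_left by (rule sum_bounded_below) (rule point)
  finally have "m * (m * D / 4 - v) \<le> m * kmeans_cost d S (core d c A)"
    by (simp add: algebra_simps)
  then have "m * D / 4 - v \<le> kmeans_cost d S (core d c A)"
    using m by simp
  \<comment> \<open>By \<open>upper\<close> it suffices that
    \<open>v / 8 + m * D / 8 \<le> m * D / 4 - v\<close>, which amounts to
    \<open>9 * v \<le> m * D\<close>; the threshold 20 yields exactly this 9.\<close>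
  then show ?thesis
    using upper far by linarith
qed

text \<open>Route every point through \<open>c\<close> to \<open>x\<close>: with \<open>v\<close>
  the cost of \<open>c\<close>, this gives \<open>2 * v\<close>, plus another \<open>4 * v\<close>
  by the definition of the core. The 6 only has to stay below 20.\<close>

lemma cost_insert_core_le:
  assumes "finite S" "x \<in> core d c A"
  shows "kmeans_cost d (insert x S) A \<le> 6 * kmeans_cost d {c} A"
proof -
  have "kmeans_cost d (insert x S) A \<le> (\<Sum>y\<in>A. 2 * (edist d y c)\<^sup>2 + 2 * (edist d x c)\<^sup>2)"
    unfolding kmeans_cost_def
  proof (rule sum_mono)
    fix y
    show "min_sqdist d (insert x S) y \<le> 2 * (edist d y c)\<^sup>2 + 2 * (edist d x c)\<^sup>2"
      using min_sqdist_le[of "insert x S" x d y] edist_sq_triangle[of d y x c] assms(1)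
      by (simp add: edist_commute[of d x c])
  qed
  also have "\<dots> = 2 * kmeans_cost d {c} A + 2 * (real (card A) * (edist d x c)\<^sup>2)"
    by (simp add: kmeans_cost_singleton sum.distrib sum_distrib_left)
  also have "\<dots> \<le> 6 * kmeans_cost d {c} A"
    using assms(2) by (simp add: core_def)
  finally show ?thesis .
qed

section \<open>The potential\<close>

text \<open>The function \<open>a\<close> fixes one nearest center per point, breaking ties, so that
  the cells are disjoint and costs add up over them.\<close>

locale reference_clustering =
  fixes d :: nat and X C :: "(nat \<Rightarrow> real) set" and a :: "(nat \<Rightarrow> real) \<Rightarrow> nat \<Rightarrow> real"
  assumes finite_X: "finite X" and finite_C: "finite C"
    and assign_in: "x \<in> X \<Longrightarrow> a x \<in> C"
    and assign_min: "x \<in> X \<Longrightarrow> min_sqdist d C x = (edist d x (a x))\<^sup>2"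
begin

definition cell :: "(nat \<Rightarrow> real) \<Rightarrow> (nat \<Rightarrow> real) set" where
  "cell c = {x \<in> X. a x = c}"

definition bad :: "(nat \<Rightarrow> real) set \<Rightarrow> (nat \<Rightarrow> real) set" where
  "bad S = {c \<in> C. 20 * kmeans_cost d {c} (cell c) < kmeans_cost d S (cell c)}"

definition good_samples :: "(nat \<Rightarrow> real) set \<Rightarrow> (nat \<Rightarrow> real) set" where
  "good_samples S = (\<Union>c\<in>bad S. core d c (cell c))"

text \<open>Before success the value is at least 1, so the potential dominates the indicator of
  failure.\<close>

definition potential :: "(nat \<Rightarrow> real) set \<Rightarrow> real" where
  "potential S = (if kmeans_cost d S X \<le> 40 * kmeans_cost d C X then 0 else 2 ^ card (bad S))"

lemma finite_cell: "finite (cell c)"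
  using finite_X by (simp add: cell_def)

lemma core_subset: "core d c (cell c) \<subseteq> cell c"
  by (auto simp: core_def)

lemma finite_bad: "finite (bad S)"
  using finite_C by (simp add: bad_def)

lemma good_samples_subset: "good_samples S \<subseteq> X"
  by (auto simp: good_samples_def core_def cell_def)

lemma kmeans_cost_cells: "kmeans_cost d S X = (\<Sum>c\<in>C. kmeans_cost d S (cell c))"
  unfolding kmeans_cost_def cell_def
  by (rule sum.group[symmetric]) (use finite_X finite_C assign_in in auto)

lemma kmeans_cost_reference: "kmeans_cost d C X = (\<Sum>c\<in>C. kmeans_cost d {c} (cell c))"
  unfolding kmeans_cost_cells
  by (rule sum.cong) (auto simp: kmeans_cost_def cell_def assign_min min_sqdist_def[of d "{_}"])

lemma potential_nonneg: "0 \<le> potential S"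
  by (simp add: potential_def)

lemma potential_le: "potential S \<le> 2 ^ card C"
  unfolding potential_def using finite_C
  by (auto intro!: power_increasing card_mono simp: bad_def)

lemma bad_insert:
  assumes "finite S" "S \<noteq> {}"
  shows "bad (insert x S) \<subseteq> bad S"
  unfolding bad_def using kmeans_cost_antimono[of "insert x S" S d] assms
  by (fastforce intro: less_le_trans)

lemma potential_insert_le:
  assumes "finite S" "S \<noteq> {}"
  shows "potential (insert x S) \<le> 2 ^ card (bad S)"
  unfolding potential_def using bad_insert[OF assms] finite_bad
  by (auto intro!: power_increasing card_mono)

text \<open>A core sample brings its cell to at most 6 times the cost of \<open>c\<close>, and no
  good cell turns bad, so the exponent drops by at least one.\<close>

lemma potential_insert_good:
  assumes S: "finite S" "S \<noteq> {}" and x: "x \<in> good_samples S"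
  shows "potential (insert x S) \<le> 2 ^ card (bad S) / 2"
proof -
  obtain c where c: "c \<in> bad S" "x \<in> core d c (cell c)"
    using x by (auto simp: good_samples_def)
  have "kmeans_cost d (insert x S) (cell c) \<le> 20 * kmeans_cost d {c} (cell c)"
    using cost_insert_core_le[OF S(1) c(2)] kmeans_cost_nonneg[of "{c}" d "cell c"] by simp
  then have "c \<notin> bad (insert x S)"
    by (auto simp: bad_def)
  then have "bad (insert x S) \<subset> bad S"
    using bad_insert[OF S, of x] c(1) by auto
  then have "Suc (card (bad (insert x S))) \<le> card (bad S)"
    using psubset_card_mono[OF finite_bad] by (simp add: Suc_le_eq)
  then have "(2::real) ^ Suc (card (bad (insert x S))) \<le> 2 ^ card (bad S)"
    by (rule power_increasing) simp
  then show ?thesis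
    by (simp add: potential_def)
qed

text \<open>Cells that are not bad account for less than half of the cost of \<open>S\<close>, since
  20 is half of 40. The bad cells carry the rest, and their cores at least 1/16 of it.\<close>

lemma cost_good_samples_ge:
  assumes S: "finite S" "S \<noteq> {}" and large: "40 * kmeans_cost d C X < kmeans_cost d S X"
  shows "kmeans_cost d S X / 32 \<le> kmeans_cost d S (good_samples S)"
proof -
  have "(\<Sum>c\<in>C - bad S. kmeans_cost d S (cell c)) \<le> (\<Sum>c\<in>C - bad S. 20 * kmeans_cost d {c} (cell c))"
    by (rule sum_mono) (auto simp: bad_def)
  also have "\<dots> \<le> (\<Sum>c\<in>C. 20 * kmeans_cost d {c} (cell c))"
    using finite_C by (intro sum_mono2) (auto simp: kmeans_cost_nonneg)
  also have "\<dots> = 20 * kmeans_cost d C X"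
    by (simp add: kmeans_cost_reference sum_distrib_left)
  finally have "(\<Sum>c\<in>C - bad S. kmeans_cost d S (cell c)) \<le> kmeans_cost d S X / 2"
    using large by linarith
  moreover have "kmeans_cost d S X
      = (\<Sum>c\<in>C - bad S. kmeans_cost d S (cell c)) + (\<Sum>c\<in>bad S. kmeans_cost d S (cell c))"
    unfolding kmeans_cost_cells using finite_C
    by (intro sum.subset_diff) (auto simp: bad_def)
  ultimately have "kmeans_cost d S X / 2 \<le> (\<Sum>c\<in>bad S. kmeans_cost d S (cell c))"
    by linarith
  then have "kmeans_cost d S X / 32 \<le> (\<Sum>c\<in>bad S. kmeans_cost d S (cell c) / 16)"
    by (simp add: sum_divide_distrib[symmetric])
  also have "\<dots> \<le> (\<Sum>c\<in>bad S. kmeans_cost d S (core d c (cell c)))"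
    by (intro sum_mono cost_core_ge finite_cell S) (simp add: bad_def)
  \<comment> \<open>The cores are disjoint because the cells are.\<close>
  also have "\<dots> = kmeans_cost d S (good_samples S)"
    unfolding kmeans_cost_def good_samples_def
    by (rule sum.UNION_disjoint[symmetric])
      (use finite_bad finite_subset[OF core_subset finite_cell] in \<open>auto simp: core_def cell_def\<close>)
  finally show ?thesis .
qed

text \<open>A good sample has probability at least 1/32 and halves the bound
  \<open>2 ^ card (bad S)\<close>, which gives the factor \<open>1 - 1/64\<close>.\<close>

lemma potential_step:
  assumes S: "finite S" "S \<noteq> {}"
  shows "(\<integral>\<^sup>+ T. ennreal (potential T) \<partial>measure_pmf (d2_step d X S)) \<le> ennreal (63/64 * potential S)"
proof (cases "kmeans_cost d S X \<le> 40 * kmeans_cost d C X")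
  case True
  \<comment> \<open>Success is permanent: centers are only added, so the cost cannot rise
    again.\<close>
  have "potential T = 0" if "T \<in> set_pmf (d2_step d X S)" for T
  proof -
    have "S \<subseteq> T" "finite T"
      using that S by (auto simp: d2_step_def split: if_splits)
    then show ?thesis
      using kmeans_cost_antimono[of T S d X] S True by (simp add: potential_def)
  qed
  then have "(\<integral>\<^sup>+ T. ennreal (potential T) \<partial>measure_pmf (d2_step d X S))
      = (\<integral>\<^sup>+ T. 0 \<partial>measure_pmf (d2_step d X S))"
    by (intro nn_integral_cong_AE) (simp add: AE_measure_pmf_iff)
  then show ?thesis
    by simp
next
  case False
  define \<Phi> B where "\<Phi> = kmeans_cost d S X" and "B = (2::real) ^ card (bad S)"
  define w where "w x = min_sqdist d S x / \<Phi>" for x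
  have "0 \<le> kmeans_cost d C X"
    unfolding kmeans_cost_reference by (intro sum_nonneg kmeans_cost_nonneg) auto
  then have \<Phi>: "\<Phi> > 0"
    using False by (simp add: \<Phi>_def)
  have w_nonneg: "0 \<le> w x" for x
    using \<Phi> min_sqdist_nonneg[OF S] by (simp add: w_def)
  have pmf: "pmf (d2_point d X S) x = (if x \<in> X then w x else 0)" for x
    using \<Phi> by (subst pmf_d2_point[OF finite_X S]) (simp_all add: \<Phi>_def w_def)
  have w_sum: "sum w A = kmeans_cost d S A / \<Phi>" for A
    by (simp add: w_def sum_divide_distrib kmeans_cost_def)
  have "(\<integral>\<^sup>+ T. ennreal (potential T) \<partial>measure_pmf (d2_step d X S))
      = (\<integral>\<^sup>+ x. ennreal (potential (insert x S)) \<partial>measure_pmf (d2_point d X S))"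
    using \<Phi> S by (simp add: d2_step_def \<Phi>_def)
  also have "\<dots> = (\<Sum>x\<in>X. ennreal (potential (insert x S)) * ennreal (w x))"
    using finite_X by (subst nn_integral_measure_pmf_support[where A = X])
      (simp_all add: pmf set_pmf_iff)
  also have "\<dots> = ennreal (\<Sum>x\<in>X. potential (insert x S) * w x)"
    by (simp add: ennreal_mult[symmetric] potential_nonneg w_nonneg)
  \<comment> \<open>\<open>B\<close> bounds the new potential for every sample, and
    \<open>B / 2\<close> can be saved on the good ones.\<close>
  also have "\<dots> \<le> ennreal (\<Sum>x\<in>X. B * w x - (if x \<in> good_samples S then B / 2 * w x else 0))"
  proof (intro ennreal_leI sum_mono)
    fix x
    show "potential (insert x S) * w x
        \<le> B * w x - (if x \<in> good_samples S then B / 2 * w x else 0)"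
      using mult_right_mono[OF potential_insert_good[OF S, of x] w_nonneg[of x]]
        mult_right_mono[OF potential_insert_le[OF S, of x] w_nonneg[of x]]
      by (auto simp: B_def mult_ac)
  qed
  also have "(\<Sum>x\<in>X. B * w x - (if x \<in> good_samples S then B / 2 * w x else 0))
      = B * sum w X - B / 2 * sum w (good_samples S)"
    using finite_X good_samples_subset[of S]
    by (simp add: sum_subtractf sum_distrib_left sum.inter_restrict[symmetric] Int_absorb1)
  also have "ennreal \<dots> \<le> ennreal (63/64 * B)"
  proof (rule ennreal_leI)
    have "1/32 \<le> sum w (good_samples S)"
      using cost_good_samples_ge[OF S] False \<Phi> by (simp add: w_sum \<Phi>_def field_simps)
    then have "B / 2 * (1/32) \<le> B / 2 * sum w (good_samples S)"
      by (intro mult_left_mono) (auto simp: B_def)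
    moreover have "sum w X = 1"
      using \<Phi> by (simp add: w_sum \<Phi>_def[symmetric])
    ultimately show "B * sum w X - B / 2 * sum w (good_samples S) \<le> 63/64 * B"
      by simp
  qed
  also have "63/64 * B = 63/64 * potential S"
    using False by (simp add: potential_def B_def)
  finally show ?thesis .
qed

end

section \<open>Sampling\<close>

text \<open>Ensures that the sets reached after the first draw are finite and nonempty, as
  \<open>potential_step\<close> requires.\<close>

lemma set_pmf_d2_sampling:
  assumes "finite X" "X \<noteq> {}" "S \<in> set_pmf (d2_sampling d X n)"
  shows "S \<subseteq> X \<and> (0 < n \<longrightarrow> S \<noteq> {})"
  using assms(3)
proof (induction n arbitrary: S)
  case 0
  then show ?case
    by simp
next
  case (Suc n)
  then obtain R where R: "R \<in> set_pmf (d2_sampling d X n)" "S \<in> set_pmf (d2_step d X R)"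
    by auto
  have RX: "R \<subseteq> X"
    using Suc.IH[OF R(1)] by simp
  then have fin: "finite R"
    using assms(1) by (rule finite_subset)
  show ?case
  proof (cases "R = {} \<or> kmeans_cost d R X = 0")
    case True
    then show ?thesis
      using R RX assms by (auto simp: d2_step_def split: if_splits)
  next
    case False
    then have "x \<in> X" if "x \<in> set_pmf (d2_point d X R)" for x
      using that pmf_d2_point[of X R d x] assms(1) fin by (auto simp: set_pmf_iff split: if_splits)
    then show ?thesis
      using False R RX by (auto simp: d2_step_def)
  qed
qed

text \<open>Of the \<open>Suc n\<close> draws only \<open>n\<close> contract: the first one is
  uniform, and after it only \<open>potential_le\<close> is used.\<close>

lemma (in reference_clustering) potential_sampling:
  assumes "X \<noteq> {}"
  shows "(\<integral>\<^sup>+ S. ennreal (potential S) \<partial>measure_pmf (d2_sampling d X (Suc n)))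
    \<le> ennreal ((63/64) ^ n * 2 ^ card C)"
proof (induction n)
  case 0
  have "(\<integral>\<^sup>+ S. ennreal (potential S) \<partial>measure_pmf (d2_sampling d X (Suc 0)))
      \<le> (\<integral>\<^sup>+ S. ennreal (2 ^ card C) \<partial>measure_pmf (d2_sampling d X (Suc 0)))"
    by (intro nn_integral_mono ennreal_leI potential_le)
  then show ?case
    by simp
next
  case (Suc n)
  let ?P = "measure_pmf (d2_sampling d X (Suc n))"
  have "(\<integral>\<^sup>+ S. ennreal (potential S) \<partial>measure_pmf (d2_sampling d X (Suc (Suc n))))
      = (\<integral>\<^sup>+ S. (\<integral>\<^sup>+ T. ennreal (potential T) \<partial>measure_pmf (d2_step d X S)) \<partial>?P)"
    unfolding d2_sampling.simps(2)[of d X "Suc n"] by (rule nn_integral_bind_pmf)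
  also have "\<dots> \<le> (\<integral>\<^sup>+ S. ennreal (63/64 * potential S) \<partial>?P)"
  proof (rule nn_integral_mono_AE, unfold AE_measure_pmf_iff, rule ballI)
    fix S assume "S \<in> set_pmf (d2_sampling d X (Suc n))"
    from set_pmf_d2_sampling[OF finite_X assms this] have "finite S" "S \<noteq> {}"
      using finite_X finite_subset by auto
    then show "(\<integral>\<^sup>+ T. ennreal (potential T) \<partial>measure_pmf (d2_step d X S))
        \<le> ennreal (63/64 * potential S)"
      by (rule potential_step)
  qed
  also have "\<dots> = ennreal (63/64) * (\<integral>\<^sup>+ S. ennreal (potential S) \<partial>?P)"
    by (simp add: ennreal_mult potential_nonneg nn_integral_cmult del: d2_sampling.simps times_divide_eq_left)
  also have "\<dots> \<le> ennreal (63/64) * ennreal ((63/64) ^ n * 2 ^ card C)"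
    by (intro mult_left_mono Suc.IH) simp
  also have "\<dots> = ennreal ((63/64) ^ Suc n * 2 ^ card C)"
    by (simp add: ennreal_mult[symmetric])
  finally show ?case .
qed

text \<open>Markov's inequality for the potential, which is at least 1 outside
  \<open>E\<close>.\<close>

lemma prob_d2_sampling_cost_le:
  assumes X: "finite X" "X \<noteq> {}" and C: "finite C" "C \<noteq> {}"
  shows "1 - (63/64) ^ n * 2 ^ card C \<le> measure_pmf.prob (d2_sampling d X (Suc n))
    {S. kmeans_cost d S X \<le> 40 * kmeans_cost d C X}"
proof -
  have "\<exists>c\<in>C. min_sqdist d C x = (edist d x c)\<^sup>2" for x
    using min_sqdist_attained[OF C] by metis
  then obtain a where "\<And>x. a x \<in> C" "\<And>x. min_sqdist d C x = (edist d x (a x))\<^sup>2"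
    by metis
  then interpret reference_clustering d X C a
    using X C by unfold_locales
  let ?P = "measure_pmf (d2_sampling d X (Suc n))"
  define E where "E = {S. kmeans_cost d S X \<le> 40 * kmeans_cost d C X}"
  have "ennreal (measure ?P (- E)) = (\<integral>\<^sup>+ S. indicator (- E) S \<partial>?P)"
    by (simp add: measure_pmf.emeasure_eq_measure del: d2_sampling.simps)
  also have "\<dots> \<le> (\<integral>\<^sup>+ S. ennreal (potential S) \<partial>?P)"
    by (intro nn_integral_mono) (auto simp: E_def potential_def indicator_def)
  also have "\<dots> \<le> ennreal ((63/64) ^ n * 2 ^ card C)"
    by (rule potential_sampling[OF X(2)])
  finally have "measure ?P (- E) \<le> (63/64) ^ n * 2 ^ card C"
    by simp
  moreover have "measure ?P (- E) = 1 - measure ?P E"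
    using measure_pmf.prob_compl[of E "d2_sampling d X (Suc n)"] by (simp add: Compl_eq_Diff_UNIV)
  ultimately show ?thesis
    by (simp add: E_def)
qed

section \<open>Optimal costs\<close>

text \<open>Provides sets of exactly \<open>k\<close> centers, so that the infimum in
  \<open>opt_cost\<close> ranges over a nonempty set.\<close>

lemma infinite_Euclidean_space:
  assumes "1 \<le> d"
  shows "infinite (topspace (Euclidean_space d))"
proof
  assume "finite (topspace (Euclidean_space d))"
  moreover have "range (\<lambda>r::real. \<lambda>i::nat. if i = 0 then r else 0) \<subseteq> topspace (Euclidean_space d)"
    using assms by (auto simp: topspace_Euclidean_space)
  moreover have "inj (\<lambda>r::real. \<lambda>i::nat. if i = 0 then r else 0)"
    by (rule injI) (metis (full_types))
  ultimately show False
    using finite_subset finite_imageD infinite_UNIV_char_0 by blast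
qed

lemma opt_cost_nonneg:
  assumes "1 \<le> d" "1 \<le> k"
  shows "0 \<le> opt_cost d k X"
proof -
  obtain C where "C \<subseteq> topspace (Euclidean_space d)" "finite C" "card C = k"
    using infinite_arbitrarily_large[OF infinite_Euclidean_space[OF assms(1)]] by blast
  then show ?thesis
    unfolding opt_cost_def using assms(2)
    by (intro cINF_greatest) (auto intro!: kmeans_cost_nonneg)
qed

text \<open>\<open>X\<close> itself is an admissible set of centers, of cost 0. Hence
  \<open>card X\<close> is a witness for the \<open>LEAST\<close> in
  \<open>num_centers\<close>.\<close>

lemma opt_cost_card:
  assumes "finite X" "X \<noteq> {}" "X \<subseteq> topspace (Euclidean_space d)"
  shows "opt_cost d (card X) X \<le> 0"
proof -
  have "bdd_below ((\<lambda>C. kmeans_cost d C X) `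
      {C. C \<subseteq> topspace (Euclidean_space d) \<and> finite C \<and> card C = card X})"
    using assms(1,2) by (intro bdd_belowI2[where m = 0] kmeans_cost_nonneg) auto
  then have "opt_cost d (card X) X \<le> kmeans_cost d X X"
    unfolding opt_cost_def using assms by (intro cINF_lower) auto
  then show ?thesis
    by (simp add: kmeans_cost_self assms(1))
qed

lemma num_centers:
  assumes "finite X" "X \<noteq> {}" "X \<subseteq> topspace (Euclidean_space d)" "1 \<le> d" "1 \<le> k" "0 \<le> \<delta>"
  shows "1 \<le> num_centers d k \<delta> X" "opt_cost d (num_centers d k \<delta> X) X \<le> \<delta> * opt_cost d k X"
proof -
  have "0 \<le> \<delta> * opt_cost d k X"
    using opt_cost_nonneg[OF assms(4,5)] assms(6) by simp
  then have "1 \<le> card X \<and> opt_cost d (card X) X \<le> \<delta> * opt_cost d k X"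
    using opt_cost_card[OF assms(1-3)] assms(1,2) by (auto simp: Suc_le_eq card_gt_0_iff)
  from LeastI[of "\<lambda>L. 1 \<le> L \<and> opt_cost d L X \<le> \<delta> * opt_cost d k X", OF this]
  show "1 \<le> num_centers d k \<delta> X" "opt_cost d (num_centers d k \<delta> X) X \<le> \<delta> * opt_cost d k X"
    unfolding num_centers_def by auto
qed

lemma prob_d2_sampling_opt_cost:
  assumes X: "finite X" "X \<noteq> {}" and "1 \<le> d" "1 \<le> L"
  shows "1 - (63/64) ^ n * 2 ^ L \<le> measure_pmf.prob (d2_sampling d X (Suc n))
    {S. kmeans_cost d S X \<le> 40 * opt_cost d L X}"
proof -
  \<comment> \<open>\<open>F\<close> collects the possible costs above the target; the added element
    keeps it nonempty, so \<open>Min F\<close> exists. A set \<open>C\<close> of cost below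
    \<open>Min F / 40\<close> then leaves no possible cost between the target and
    \<open>40 * kmeans_cost d C X\<close>.\<close>
  define F where "F = insert (40 * opt_cost d L X + 1)
    {v \<in> (\<lambda>S. kmeans_cost d S X) ` Pow X. 40 * opt_cost d L X < v}"
  have F: "finite F" "F \<noteq> {}"
    using X(1) by (auto simp: F_def)
  have "40 * opt_cost d L X < Min F"
    using F by (subst Min_gr_iff) (auto simp: F_def)
  then have "opt_cost d L X < Min F / 40"
    by simp
  moreover obtain D where "D \<subseteq> topspace (Euclidean_space d)" "finite D" "card D = L"
    using infinite_arbitrarily_large[OF infinite_Euclidean_space[OF assms(3)]] by blast
  ultimately obtain C where C: "finite C" "card C = L" "kmeans_cost d C X < Min F / 40"
    unfolding opt_cost_def using cInf_lessD[of "(\<lambda>C. kmeans_cost d C X) `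
      {C. C \<subseteq> topspace (Euclidean_space d) \<and> finite C \<and> card C = L}"] by blast
  have "1 - (63/64) ^ n * 2 ^ L \<le> measure_pmf.prob (d2_sampling d X (Suc n))
      {S. kmeans_cost d S X \<le> 40 * kmeans_cost d C X}"
    using prob_d2_sampling_cost_le[OF X C(1), of n d] C(2) assms(4) by fastforce
  also have "\<dots> \<le> measure_pmf.prob (d2_sampling d X (Suc n))
      {S. kmeans_cost d S X \<le> 40 * opt_cost d L X}"
  proof (rule measure_pmf.finite_measure_mono_AE)
    have "kmeans_cost d S X \<le> 40 * opt_cost d L X"
      if "S \<subseteq> X" "kmeans_cost d S X \<le> 40 * kmeans_cost d C X" for S
    proof (rule ccontr)
      assume "\<not> ?thesis"
      then have "kmeans_cost d S X \<in> F"
        using that(1) by (auto simp: F_def)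
      then show False
        using Min_le[OF F(1)] that(2) C(3) by fastforce
    qed
    then show "AE S in measure_pmf (d2_sampling d X (Suc n)).
        S \<in> {S. kmeans_cost d S X \<le> 40 * kmeans_cost d C X} \<longrightarrow>
        S \<in> {S. kmeans_cost d S X \<le> 40 * opt_cost d L X}"
      using set_pmf_d2_sampling[OF X] by (simp add: AE_measure_pmf_iff del: d2_sampling.simps)
  qed simp
  finally show ?thesis .
qed

section \<open>Numerical constants and conclusion\<close>

lemma failure_bound:
  assumes "1 \<le> L" "200 * real L \<le> real (Suc n)"
  shows "(63/64) ^ n * 2 ^ L \<le> exp (- real (Suc n) / 200)"
proof -
  have "(63/64::real) \<le> exp (- (1/64))" "(2::real) \<le> exp 1"
    using exp_ge_add_one_self[of "- (1/64)::real"] exp_ge_add_one_self[of "1::real"] by simp_all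
  then have "(63/64::real) ^ n * 2 ^ L \<le> exp (- (1/64)) ^ n * exp 1 ^ L"
    by (intro mult_mono power_mono) auto
  also have "\<dots> = exp (real L - real n / 64)"
    by (simp add: exp_of_nat_mult[symmetric] exp_add[symmetric])
  \<comment> \<open>As \<open>L\<close> is at most \<open>(n + 1) / 200\<close>, it suffices that
    \<open>(n + 1) / 100 \<le> n / 64\<close>, which holds because \<open>1 \<le> L\<close> forces
    \<open>n \<ge> 199\<close>.\<close>
  also have "\<dots> \<le> exp (- real (Suc n) / 200)"
    using assms by simp
  finally show ?thesis .
qed

theorem theorem4:
  shows "\<exists>c::real. 1 \<le> c \<and> (\<exists>K::real. 0 < K \<and>
    (\<forall>(\<epsilon>::real) (k::nat) (d::nat) (X::(nat \<Rightarrow> real) set) (s::nat).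
      0 < \<epsilon> \<and> \<epsilon> \<le> 1 \<and> 1 \<le> k \<and> 1 \<le> d \<and>
      X \<subseteq> topspace (Euclidean_space d) \<and> finite X \<and> X \<noteq> {} \<and>
      K * real (num_centers d k (\<epsilon> / c) X) \<le> real s
      \<longrightarrow> 1 - exp (- real s / K) \<le>
          measure_pmf.prob (d2_sampling d X s)
            {S. kmeans_cost d S X \<le> \<epsilon> * opt_cost d k X}))"
\<comment> \<open>40 is the approximation factor against \<open>L\<close> optimal centers, cancelled
  by \<open>\<epsilon> / 40\<close>. 200 serves both as samples per center and as the rate in the
  exponent.\<close>
proof (rule exI[of _ 40], rule conjI, simp, rule exI[of _ 200], rule conjI, simp, intro allI impI)
  fix \<epsilon> :: real and k d :: nat and X :: "(nat \<Rightarrow> real) set" and s :: nat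
  assume *: "0 < \<epsilon> \<and> \<epsilon> \<le> 1 \<and> 1 \<le> k \<and> 1 \<le> d \<and>
      X \<subseteq> topspace (Euclidean_space d) \<and> finite X \<and> X \<noteq> {} \<and>
      200 * real (num_centers d k (\<epsilon> / 40) X) \<le> real s"
  define L where "L = num_centers d k (\<epsilon> / 40) X"
  have L: "1 \<le> L" "40 * opt_cost d L X \<le> \<epsilon> * opt_cost d k X"
    using num_centers[of X d k "\<epsilon> / 40"] * by (auto simp: L_def)
  have s: "200 * real L \<le> real s"
    using * by (simp add: L_def)
  then obtain n where n: "s = Suc n"
    using L(1) by (cases s) auto
  have "1 - exp (- real s / 200) \<le> 1 - (63/64) ^ n * 2 ^ L"
    using failure_bound[OF L(1), of n] s by (simp add: n)
  also have "\<dots> \<le> measure_pmf.prob (d2_sampling d X s) {S. kmeans_cost d S X \<le> 40 * opt_cost d L X}"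
    unfolding n using * L(1) by (intro prob_d2_sampling_opt_cost) auto
  also have "\<dots> \<le> measure_pmf.prob (d2_sampling d X s) {S. kmeans_cost d S X \<le> \<epsilon> * opt_cost d k X}"
    using L(2) by (intro measure_pmf.finite_measure_mono) auto
  finally show "1 - exp (- real s / 200) \<le>
      measure_pmf.prob (d2_sampling d X s) {S. kmeans_cost d S X \<le> \<epsilon> * opt_cost d k X}" .
qed

end
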